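(* If $T$ is a (finite) tree, then the Cartesian product $T \square K_2$ is containable.
   Context: Graphs are finite, simple and undirected. $T \square K_2$ consists of two disjoint copies $T$, $T'$ of the tree with an edge joining each vertex of $T$ to the corresponding vertex of $T'$. Containment: on a connected graph $G$, some number of cops are first placed on edges of $G$ (several cops may share an edge), then the robber chooses a vertex. They then alternate turns, cops first, with full information. On the cops' turn each cop stays put or moves to an adjacent edge (an edge sharing an endpoint with her current edge; moving through a vertex occupied by the robber is allowed). On the robber's turn he stays put or moves to an adjacent vertex along an edge not currently occupied by a cop. The cops win (contain the robber) if at some time it is the robber's turn and every edge incident with the robber's vertex is occupied by at least one cop. A connected graph $G$ is called containable if $\Delta(G)$ cops (where $\Delta(G)$ is the maximum degree) have a strategy guaranteeing a win on $G$. *)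

theory Defs
  imports Main
begin

section \<open>Finite simple graphs\<close>

record 'a ugraph =
  vertices :: "'a set"
  edges :: "'a set set"

definition simple_graph :: "'a ugraph \<Rightarrow> bool" where
  "simple_graph G \<longleftrightarrow> finite (vertices G) \<and> (\<forall>e\<in>edges G. e \<subseteq> vertices G \<and> card e = 2)"

definition connected_graph :: "'a ugraph \<Rightarrow> bool" where
  "connected_graph G \<longleftrightarrow> simple_graph G \<and> vertices G \<noteq> {} \<and>
     (\<forall>u\<in>vertices G. \<forall>v\<in>vertices G. (u, v) \<in> {(x, y). {x, y} \<in> edges G}\<^sup>*)"

definition is_cycle :: "'a ugraph \<Rightarrow> 'a list \<Rightarrow> bool" where
  "is_cycle G xs \<longleftrightarrow> 3 \<le> length xs \<and> distinct xs \<and>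
     (\<forall>i<length xs. {xs ! i, xs ! (Suc i mod length xs)} \<in> edges G)"

definition tree :: "'a ugraph \<Rightarrow> bool" where
  "tree G \<longleftrightarrow> connected_graph G \<and> (\<nexists>xs. is_cycle G xs)"

definition degree :: "'a ugraph \<Rightarrow> 'a \<Rightarrow> nat" where
  "degree G v = card {e \<in> edges G. v \<in> e}"

definition max_degree :: "'a ugraph \<Rightarrow> nat" where
  "max_degree G = Max (degree G ` vertices G)"

definition cartesian_product :: "'a ugraph \<Rightarrow> 'b ugraph \<Rightarrow> ('a \<times> 'b) ugraph" (infixl "\<box>" 70) where
  "G \<box> H = \<lparr> vertices = vertices G \<times> vertices H,
     edges = {{(u, x), (v, x)} | u v x. {u, v} \<in> edges G \<and> x \<in> vertices H} \<union>
             {{(u, x), (u, y)} | u x y. u \<in> vertices G \<and> {x, y} \<in> edges H} \<rparr>"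

definition K2 :: "bool ugraph" where
  "K2 = \<lparr> vertices = {False, True}, edges = {{False, True}} \<rparr>"

section \<open>The containment game\<close>

text \<open>A position of \<open>k\<close> cops is a list of \<open>k\<close> edges; repetitions in the list mean that
  several cops share an edge.\<close>

definition cop_positions :: "'a ugraph \<Rightarrow> nat \<Rightarrow> 'a set list set" where
  "cop_positions G k = {c. length c = k \<and> set c \<subseteq> edges G}"

definition adjacent_edges :: "'a set \<Rightarrow> 'a set \<Rightarrow> bool" where
  "adjacent_edges e e' \<longleftrightarrow> e \<noteq> e' \<and> e \<inter> e' \<noteq> {}"

definition cop_move :: "'a ugraph \<Rightarrow> 'a set list \<Rightarrow> 'a set list \<Rightarrow> bool" where
  "cop_move G c c' \<longleftrightarrow>
     list_all2 (\<lambda>e e'. e' = e \<or> e' \<in> edges G \<and> adjacent_edges e e') c c'"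

definition robber_move :: "'a ugraph \<Rightarrow> 'a set list \<Rightarrow> 'a \<Rightarrow> 'a \<Rightarrow> bool" where
  "robber_move G c r r' \<longleftrightarrow> r' = r \<or> {r, r'} \<in> edges G \<and> {r, r'} \<notin> set c"

definition contained :: "'a ugraph \<Rightarrow> 'a set list \<Rightarrow> 'a \<Rightarrow> bool" where
  "contained G c r \<longleftrightarrow> (\<forall>e\<in>edges G. r \<in> e \<longrightarrow> e \<in> set c)"

text \<open>A cop strategy maps the list of all robber positions seen so far to the next cop
  position. Thus \<open>\<sigma> []\<close> is the initial placement, made before the robber chooses \<open>R 0\<close>,
  and \<open>\<sigma> [R 0, \<dots>, R n]\<close> is the cop position reached by the cops' turn number \<open>n\<close>. The
  cops' own earlier moves are determined by \<open>\<sigma>\<close>, so they need not be part of the argument.\<close>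

definition cop_pos :: "('a list \<Rightarrow> 'a set list) \<Rightarrow> (nat \<Rightarrow> 'a) \<Rightarrow> nat \<Rightarrow> 'a set list" where
  "cop_pos \<sigma> R n = \<sigma> (map R [0..<n])"

definition robber_play ::
    "'a ugraph \<Rightarrow> ('a list \<Rightarrow> 'a set list) \<Rightarrow> (nat \<Rightarrow> 'a) \<Rightarrow> bool" where
  "robber_play G \<sigma> R \<longleftrightarrow> R 0 \<in> vertices G \<and>
     (\<forall>n. robber_move G (cop_pos \<sigma> R (Suc n)) (R n) (R (Suc n)))"

text \<open>After the cops' turn number \<open>n\<close> it is the robber's turn, with the cops at
  \<open>cop_pos \<sigma> R (Suc n)\<close> and the robber at \<open>R n\<close>. Plays are infinite sequences: the robber may
  always stay put, and what happens after he has been contained is irrelevant.\<close>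

definition winning_strategy ::
    "'a ugraph \<Rightarrow> nat \<Rightarrow> ('a list \<Rightarrow> 'a set list) \<Rightarrow> bool" where
  "winning_strategy G k \<sigma> \<longleftrightarrow> \<sigma> [] \<in> cop_positions G k \<and>
     (\<forall>R. robber_play G \<sigma> R \<longrightarrow>
        (\<forall>n. cop_move G (cop_pos \<sigma> R n) (cop_pos \<sigma> R (Suc n))) \<and>
        (\<exists>n. contained G (cop_pos \<sigma> R (Suc n)) (R n)))"

definition containable :: "'a ugraph \<Rightarrow> bool" where
  "containable G \<longleftrightarrow> connected_graph G \<and> (\<exists>\<sigma>. winning_strategy G (max_degree G) \<sigma>)"

end

theory Submission imports Defs begin

text \<open>Write \<open>\<Delta>\<close> for the maximum degree of \<open>T\<close>, so that \<open>\<Delta> + 1\<close> cops are available. They guard an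
  edge \<open>vw\<close> of \<open>T\<close> by putting \<open>\<Delta>\<close> cops on one copy of it and one cop on the other copy. As \<open>vw\<close> is
  a bridge of \<open>T\<close>, the robber is confined to the side of \<open>w\<close>, say. If he is not above \<open>w\<close>, all cops
  advance to the next edge towards him, which shrinks his territory. If he is at the copy of \<open>w\<close> in
  the layer of the \<open>\<Delta>\<close> cops, these spread over the edges of that layer at \<open>w\<close>, while the single
  cop moves to the rung of \<open>w\<close>. If he is at the other copy of \<open>w\<close>, the \<open>\<Delta>\<close> cops move to the rung
  of \<open>w\<close>. Then he either waits, and they spread from the rung, or he advances to a copy of a
  neighbour \<open>w'\<close> of \<open>w\<close>, and all cops move on to the two copies of \<open>ww'\<close>.\<close>

section \<open>Winning in a bounded number of turns\<close>

text \<open>In \<open>cops_win_within G n c r\<close> it is the cops' turn.\<close>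

fun cops_win_within :: "'a ugraph \<Rightarrow> nat \<Rightarrow> 'a set list \<Rightarrow> 'a \<Rightarrow> bool" where
  "cops_win_within G 0 c r \<longleftrightarrow> False"
| "cops_win_within G (Suc n) c r \<longleftrightarrow> (\<exists>c'. cop_move G c c' \<and>
     (contained G c' r \<or> (\<forall>r'. robber_move G c' r r' \<longrightarrow> cops_win_within G n c' r')))"

lemma cop_move_refl: "cop_move G c c"
  by (simp add: cop_move_def list_all2_refl)

text \<open>The strategy keeps count of the remaining turns: always answering with an arbitrary move into
  the winning region might never make progress. The history is passed with the latest position
  first.\<close>

definition best_reply :: "'a ugraph \<Rightarrow> nat \<Rightarrow> 'a set list \<Rightarrow> 'a \<Rightarrow> 'a set list" where
  "best_reply G n c r = (if cops_win_within G (Suc n) c r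
     then SOME c'. cop_move G c c' \<and>
       (contained G c' r \<or> (\<forall>r'. robber_move G c' r r' \<longrightarrow> cops_win_within G n c' r'))
     else c)"

primrec countdown_strategy ::
    "'a ugraph \<Rightarrow> nat \<Rightarrow> 'a set list \<Rightarrow> 'a list \<Rightarrow> 'a set list" where
  "countdown_strategy G N c [] = c"
| "countdown_strategy G N c (r # rs) =
     best_reply G (N - Suc (length rs)) (countdown_strategy G N c rs) r"

lemma best_reply_winning:
  assumes "cops_win_within G (Suc n) c r"
  shows "cop_move G c (best_reply G n c r) \<and>
    (contained G (best_reply G n c r) r \<or>
     (\<forall>r'. robber_move G (best_reply G n c r) r r' \<longrightarrow> cops_win_within G n (best_reply G n c r) r'))"
proof -
  from assms have "\<exists>c'. cop_move G c c' \<and>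
     (contained G c' r \<or> (\<forall>r'. robber_move G c' r r' \<longrightarrow> cops_win_within G n c' r'))"
    by simp
  from someI_ex[OF this] show ?thesis
    using assms by (simp only: best_reply_def if_True)
qed

text \<open>\<open>winning_strategy\<close> demands legal moves on every turn, also after
  containment or when the count has run out. The default \<open>c\<close> of
  \<open>best_reply\<close>, where all cops stay put, guarantees this.\<close>

lemma cop_move_best_reply: "cop_move G c (best_reply G n c r)"
proof (cases "cops_win_within G (Suc n) c r")
  case True
  then show ?thesis by (rule best_reply_winning[THEN conjunct1])
next
  case False
  then show ?thesis by (simp only: best_reply_def if_False cop_move_refl)
qed

lemma winning_strategy_if_cops_win_within:
  assumes c: "c \<in> cop_positions G k"
    and win: "\<And>r. r \<in> vertices G \<Longrightarrow> cops_win_within G N c r"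
  shows "\<exists>\<sigma>. winning_strategy G k \<sigma>"
proof -
  define \<sigma> where "\<sigma> = (\<lambda>rs. countdown_strategy G N c (rev rs))"
  have pos_0: "cop_pos \<sigma> R 0 = c" for R
    by (simp add: cop_pos_def \<sigma>_def)
  have pos_Suc: "cop_pos \<sigma> R (Suc n) = best_reply G (N - Suc n) (cop_pos \<sigma> R n) (R n)" for R n
    by (simp add: cop_pos_def \<sigma>_def)
  have "\<exists>n. contained G (cop_pos \<sigma> R (Suc n)) (R n)" if play: "robber_play G \<sigma> R" for R
  proof (rule ccontr)
    assume free: "\<not> ?thesis"
    \<comment> \<open>If he is never contained, every turn passes the win on with one turn fewer; at
      \<open>n = N\<close> none is left, which is absurd.\<close>
    have "cops_win_within G (N - n) (cop_pos \<sigma> R n) (R n)" if "n \<le> N" for n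
      using that
    proof (induction n)
      case 0
      show ?case using play win by (simp add: pos_0 robber_play_def)
    next
      case (Suc n)
      then have "cops_win_within G (Suc (N - Suc n)) (cop_pos \<sigma> R n) (R n)"
        by (simp add: Suc_diff_Suc del: cops_win_within.simps)
      from best_reply_winning[OF this] have
        "robber_move G (cop_pos \<sigma> R (Suc n)) (R n) r' \<Longrightarrow>
          cops_win_within G (N - Suc n) (cop_pos \<sigma> R (Suc n)) r'" for r'
        using free unfolding pos_Suc by blast
      then show ?case using play by (simp add: robber_play_def)
    qed
    from this[of N] show False by simp
  qed
  moreover have "cop_move G (cop_pos \<sigma> R n) (cop_pos \<sigma> R (Suc n))" for R n
    unfolding pos_Suc by (rule cop_move_best_reply)
  moreover have "\<sigma> [] \<in> cop_positions G k" using c by (simp add: \<sigma>_def)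
  ultimately show ?thesis unfolding winning_strategy_def by blast
qed

section \<open>Sides of an edge in a tree\<close>

lemma simple_graph_edgeE:
  assumes "simple_graph G" "e \<in> edges G"
  obtains u v where "e = {u, v}"
proof -
  have "card e = 2" using assms by (simp add: simple_graph_def)
  then show thesis using that by (auto simp: card_2_iff)
qed

lemma simple_graph_edge_neq: "simple_graph G \<Longrightarrow> {v, w} \<in> edges G \<Longrightarrow> v \<noteq> w"
  by (auto simp: simple_graph_def)

lemma simple_graph_edge_vertices:
  "simple_graph G \<Longrightarrow> {v, w} \<in> edges G \<Longrightarrow> v \<in> vertices G \<and> w \<in> vertices G"
  by (auto simp: simple_graph_def)

lemma simple_graph_finite_edges: "simple_graph G \<Longrightarrow> finite (edges G)"
  unfolding simple_graph_def by (rule finite_subset[of _ "Pow (vertices G)"]) auto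

text \<open>The component of \<open>w\<close> after deletion of the edge \<open>vw\<close>: the
  robber's territory while both copies of \<open>vw\<close> are guarded.\<close>

definition side :: "'a ugraph \<Rightarrow> 'a \<Rightarrow> 'a \<Rightarrow> 'a set" where
  "side G v w = {x. (w, x) \<in> {(a, b). {a, b} \<in> edges G - {{v, w}}}\<^sup>*}"

lemma side_self: "w \<in> side G v w"
  by (simp add: side_def)

lemma side_step:
  "x \<in> side G v w \<Longrightarrow> {x, y} \<in> edges G \<Longrightarrow> {x, y} \<noteq> {v, w} \<Longrightarrow> y \<in> side G v w"
  unfolding side_def by (auto intro: rtrancl_into_rtrancl)

lemma side_induct [consumes 1, case_names self step]:
  assumes "x \<in> side G v w" and "P w"
    and "\<And>x y. x \<in> side G v w \<Longrightarrow> P x \<Longrightarrow> {x, y} \<in> edges G \<Longrightarrow> {x, y} \<noteq> {v, w} \<Longrightarrow> P y"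
  shows "P x"
proof -
  have "(w, x) \<in> {(a, b). {a, b} \<in> edges G - {{v, w}}}\<^sup>*"
    using assms(1) by (simp add: side_def)
  then show ?thesis
    by (induction rule: rtrancl_induct) (use assms(2,3) in \<open>auto simp: side_def\<close>)
qed

lemma side_subset_vertices:
  assumes "simple_graph G" "w \<in> vertices G"
  shows "side G v w \<subseteq> vertices G"
proof
  fix x assume "x \<in> side G v w"
  then show "x \<in> vertices G"
    by (induction rule: side_induct) (use assms simple_graph_edge_vertices[OF assms(1)] in auto)
qed

text \<open>A step to a vertex already on the path is absorbed by cutting the path off at that
  vertex.\<close>

lemma rtrancl_distinct_path:
  assumes "(a, b) \<in> r\<^sup>*"
  shows "\<exists>xs. xs \<noteq> [] \<and> hd xs = a \<and> last xs = b \<and> distinct xs \<and>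
    (\<forall>i. Suc i < length xs \<longrightarrow> (xs ! i, xs ! Suc i) \<in> r)"
  using assms
proof (induction rule: rtrancl_induct)
  case base
  show ?case by (rule exI[of _ "[a]"]) auto
next
  case (step y z)
  then obtain xs where xs: "xs \<noteq> []" "hd xs = a" "last xs = y" "distinct xs"
    "\<forall>i. Suc i < length xs \<longrightarrow> (xs ! i, xs ! Suc i) \<in> r" by blast
  show ?case
  proof (cases "z \<in> set xs")
    case True
    then obtain j where j: "j < length xs" "xs ! j = z" by (auto simp: in_set_conv_nth)
    show ?thesis
    proof (intro exI conjI)
      show "take (Suc j) xs \<noteq> []" "hd (take (Suc j) xs) = a" "distinct (take (Suc j) xs)"
        using xs by auto
      show "last (take (Suc j) xs) = z"
        using j by (simp add: take_Suc_conv_app_nth)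
      show "\<forall>i. Suc i < length (take (Suc j) xs) \<longrightarrow>
          (take (Suc j) xs ! i, take (Suc j) xs ! Suc i) \<in> r"
        using xs(5) by simp
    qed
  next
    case False
    have "((xs @ [z]) ! i, (xs @ [z]) ! Suc i) \<in> r" if "Suc i < length (xs @ [z])" for i
    proof (cases "Suc i < length xs")
      case True
      then show ?thesis using xs(5) by (simp add: nth_append)
    next
      case False
      with that have "Suc i = length xs" by simp
      then have "xs ! i = y" using xs(1,3) by (metis diff_Suc_1 last_conv_nth)
      then show ?thesis using \<open>Suc i = length xs\<close> step.hyps(2) by (simp add: nth_append)
    qed
    then show ?thesis using xs False by (intro exI[of _ "xs @ [z]"]) auto
  qed
qed

text \<open>A path from \<open>w\<close> to \<open>v\<close> that avoids the edge \<open>vw\<close>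
  would close up with it to a cycle.\<close>

lemma tree_bridge:
  assumes "tree T" "{v, w} \<in> edges T"
  shows "v \<notin> side T v w"
proof
  assume "v \<in> side T v w"
  then obtain xs where xs: "xs \<noteq> []" "hd xs = w" "last xs = v" "distinct xs"
    and path: "\<forall>i. Suc i < length xs \<longrightarrow> {xs ! i, xs ! Suc i} \<in> edges T - {{v, w}}"
    using rtrancl_distinct_path[of w v "{(a, b). {a, b} \<in> edges T - {{v, w}}}"]
    by (auto simp: side_def)
  have "v \<noteq> w"
    by (rule simple_graph_edge_neq) (use assms in \<open>auto simp: tree_def connected_graph_def\<close>)
  have hd: "xs ! 0 = w" using xs by (simp add: hd_conv_nth)
  have last: "xs ! (length xs - 1) = v" using xs by (simp add: last_conv_nth)
  \<comment> \<open>One vertex would mean \<open>v = w\<close>, and two would make the deleted edge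
    the whole path.\<close>
  have "length xs \<noteq> 1" using hd last \<open>v \<noteq> w\<close> by auto
  moreover have "length xs \<noteq> 2"
  proof
    assume "length xs = 2"
    then have "{w, v} \<noteq> {v, w}" using path[rule_format, of 0] hd last by auto
    then show False by auto
  qed
  moreover have "length xs \<noteq> 0" using xs by simp
  ultimately have len: "3 \<le> length xs" by linarith
  have "{xs ! i, xs ! (Suc i mod length xs)} \<in> edges T" if "i < length xs" for i
  proof (cases "Suc i = length xs")
    case True
    then have "i = length xs - 1" by simp
    then show ?thesis using True hd last assms(2) by simp
  next
    case False
    then show ?thesis using that path by simp
  qed
  then have "is_cycle T xs" using len xs by (simp add: is_cycle_def)
  then show False using assms by (auto simp: tree_def)
qed

text \<open>A walk can leave a side only across \<open>vw\<close> itself, and then it arrives at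
  \<open>v\<close> or \<open>w\<close>, each of which lies in its own side.\<close>

lemma connected_graph_sides:
  assumes "connected_graph G" "w \<in> vertices G" "x \<in> vertices G"
  shows "x \<in> side G v w \<or> x \<in> side G w v"
proof -
  have "(w, x) \<in> {(x, y). {x, y} \<in> edges G}\<^sup>*"
    using assms by (simp add: connected_graph_def)
  then show ?thesis
  proof (induction rule: rtrancl_induct)
    case base
    show ?case by (simp add: side_self)
  next
    case (step y z)
    then show ?case
      by (cases "{y, z} = {v, w}")
        (auto simp: doubleton_eq_iff side_self intro: side_step)
  qed
qed

text \<open>Along a walk from \<open>w\<close>, the vertex entered at the latest departure from
  \<open>w\<close> serves as \<open>w'\<close>; a return to \<open>w\<close> discards it. This finds
  the edge to which the cops advance.\<close>

lemma side_next_edge: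
  assumes "x \<in> side G v w" "x \<noteq> w"
  obtains w' where "{w, w'} \<in> edges G" "w' \<noteq> v" "x \<in> side G w w'"
proof -
  have "x = w \<or> (\<exists>w'. {w, w'} \<in> edges G \<and> w' \<noteq> v \<and> x \<in> side G w w')"
    using assms(1)
  proof (induction rule: side_induct)
    case self
    show ?case by simp
  next
    case (step x y)
    show ?case
    proof (cases "x = w \<or> y = w")
      case True
      then show ?thesis using step by (auto simp: insert_commute intro: side_self)
    next
      case False
      with step obtain w' where w': "{w, w'} \<in> edges G" "w' \<noteq> v" "x \<in> side G w w'" by blast
      moreover have "{x, y} \<noteq> {w, w'}" using False by auto
      ultimately show ?thesis using step.hyps side_step by metis
    qed
  qed
  then show thesis using assms(2) that by blast
qed

text \<open>As \<open>ww'\<close> is a bridge, a walk inside \<open>side T w w'\<close> never meets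
  \<open>w\<close> and so never uses \<open>vw\<close>. The vertex \<open>w\<close> itself makes the
  inclusion strict, so the territory can serve as a termination measure.\<close>

lemma tree_side_psubset:
  assumes "tree T" "{w, w'} \<in> edges T" "w' \<noteq> v"
  shows "side T w w' \<subset> side T v w"
proof -
  have w: "w \<notin> side T w w'" by (rule tree_bridge[OF assms(1,2)])
  have "z \<in> side T v w" if "z \<in> side T w w'" for z
    using that
  proof (induction rule: side_induct)
    case self
    show ?case
      by (rule side_step[OF side_self assms(2)]) (use assms(3) in \<open>auto simp: doubleton_eq_iff\<close>)
  next
    case (step x y)
    then have "x \<noteq> w" "y \<noteq> w" using w side_step by metis+
    then have "{x, y} \<noteq> {v, w}" by auto
    then show ?case by (rule side_step[OF step.IH step.hyps(2)])
  qed
  then have "side T w w' \<subseteq> side T v w" by (rule subsetI)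
  then show ?thesis using w side_self[of w T v] by (auto simp: psubset_eq)
qed

section \<open>The prism over a graph\<close>

definition layer :: "bool \<Rightarrow> 'a set \<Rightarrow> ('a \<times> bool) set" where
  "layer s e = (\<lambda>u. (u, s)) ` e"

definition rung :: "'a \<Rightarrow> ('a \<times> bool) set" where
  "rung u = {(u, False), (u, True)}"

lemma layer_doubleton: "layer s {u, v} = {(u, s), (v, s)}"
  by (simp add: layer_def)

lemma mem_layer [simp]: "(u, t) \<in> layer s e \<longleftrightarrow> t = s \<and> u \<in> e"
  by (auto simp: layer_def)

lemma mem_rung [simp]: "(u, t) \<in> rung w \<longleftrightarrow> u = w"
  by (cases t) (auto simp: rung_def)

lemma layer_eq_empty_iff [simp]: "layer s e = {} \<longleftrightarrow> e = {}"
  by (simp add: layer_def)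

lemma inj_layer: "inj (layer s)"
  by (rule injI) (auto simp: set_eq_iff)

lemma layer_meets_layer: "w \<in> e \<Longrightarrow> w \<in> e' \<Longrightarrow> layer s e \<inter> layer s e' \<noteq> {}"
  by (auto simp: layer_def)

lemma layer_meets_rung: "w \<in> e \<Longrightarrow> layer s e \<inter> rung w \<noteq> {}"
  by (cases s) (auto simp: layer_def rung_def)

lemma rung_meets_layer: "w \<in> e \<Longrightarrow> rung w \<inter> layer s e \<noteq> {}"
  using layer_meets_rung by (simp add: Int_commute)

lemma card_layer: "card (layer s e) = card e"
  unfolding layer_def by (rule card_image) (auto simp: inj_on_def)

lemma vertices_prism: "vertices (G \<box> K2) = vertices G \<times> UNIV"
  by (auto simp: cartesian_product_def K2_def)

lemma edges_prism:
  assumes "simple_graph G"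
  shows "edges (G \<box> K2) = {layer s e | s e. e \<in> edges G} \<union> rung ` vertices G"
    (is "?L = ?R")
proof
  show "?L \<subseteq> ?R"
  proof
    fix f assume "f \<in> ?L"
    then consider u v x where "f = {(u, x), (v, x)}" "{u, v} \<in> edges G"
      | u x y where "f = {(u, x), (u, y)}" "u \<in> vertices G" "{x, y} = {False, True}"
      by (auto simp: cartesian_product_def K2_def)
    then show "f \<in> ?R"
    proof cases
      case 1
      then have "f = layer x {u, v}" by (simp add: layer_doubleton)
      with 1 show ?thesis by blast
    next
      case 2
      then have "f = rung u" by (auto simp: rung_def doubleton_eq_iff)
      with 2 show ?thesis by blast
    qed
  qed
  show "?R \<subseteq> ?L"
  proof
    fix f assume "f \<in> ?R"
    then consider s e where "f = layer s e" "e \<in> edges G"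
      | u where "f = rung u" "u \<in> vertices G" by blast
    then show "f \<in> ?L"
    proof cases
      case 1
      then obtain u v where "e = {u, v}"
        using simple_graph_edgeE[OF assms] by metis
      with 1 have "f \<in> {{(u, x), (v, x)} | u v x. {u, v} \<in> edges G \<and> x \<in> vertices K2}"
        using layer_doubleton[of s u v] by (auto simp: K2_def)
      then show ?thesis by (simp add: cartesian_product_def)
    next
      case 2
      then have "{{False, True}} = edges K2" by (simp add: K2_def)
      then have "f \<in> {{(u, x), (u, y)} | u x y. u \<in> vertices G \<and> {x, y} \<in> edges K2}"
        using 2 unfolding rung_def by blast
      then show ?thesis by (simp add: cartesian_product_def)
    qed
  qed
qed

lemma simple_graph_prism:
  assumes "simple_graph G"
  shows "simple_graph (G \<box> K2)"
proof -
  have "card (rung u) = 2" for u :: 'a by (simp add: rung_def)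
  then show ?thesis
    using assms unfolding simple_graph_def edges_prism[OF assms] vertices_prism
    by (auto simp: card_layer) (auto simp: layer_def rung_def)
qed

text \<open>Walk inside the starting layer to the copy of the target, then along its rung if the
  layers differ.\<close>

lemma connected_graph_prism:
  assumes "connected_graph G"
  shows "connected_graph (G \<box> K2)"
proof -
  have simple: "simple_graph G" using assms by (simp add: connected_graph_def)
  let ?A = "{(x, y). {x, y} \<in> edges (G \<box> K2)}"
  have along: "((u, s), (v, s)) \<in> ?A\<^sup>*" if "(u, v) \<in> {(x, y). {x, y} \<in> edges G}\<^sup>*" for u v s
    using that
  proof (induction rule: rtrancl_induct)
    case (step y z)
    then have "((y, s), (z, s)) \<in> ?A"
      using layer_doubleton[of s y z] by (auto simp: edges_prism[OF simple])
    with step.IH show ?case by (rule rtrancl_into_rtrancl)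
  qed simp
  have across: "((v, s), (v, t)) \<in> ?A\<^sup>*" if "v \<in> vertices G" for v s t
  proof (cases "s = t")
    case False
    then have "{(v, s), (v, t)} = rung v" by (auto simp: rung_def)
    then show ?thesis using that by (auto simp: edges_prism[OF simple])
  qed simp
  have "((u, s), (v, t)) \<in> ?A\<^sup>*" if "u \<in> vertices G" "v \<in> vertices G" for u v s t
  proof -
    have "((u, s), (v, s)) \<in> ?A\<^sup>*"
      by (rule along) (use assms that in \<open>simp add: connected_graph_def\<close>)
    also have "((v, s), (v, t)) \<in> ?A\<^sup>*" using that(2) by (rule across)
    finally show ?thesis .
  qed
  then show ?thesis
    using assms simple_graph_prism[OF simple] unfolding connected_graph_def
    by (auto simp: vertices_prism)
qed

section \<open>Incident edges and degrees in the prism\<close>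

lemma contained_iff: "contained G c r \<longleftrightarrow> {e \<in> edges G. r \<in> e} \<subseteq> set c"
  by (auto simp: contained_def)

text \<open>Counted, these edges give the degree; through \<open>contained_iff\<close> they are the
  edges that the cops must occupy.\<close>

lemma prism_incident_edges:
  assumes "simple_graph G" "w \<in> vertices G"
  shows "{f \<in> edges (G \<box> K2). (w, s) \<in> f} = insert (rung w) (layer s ` {e \<in> edges G. w \<in> e})"
    (is "?L = ?R")
proof
  show "?L \<subseteq> ?R"
  proof
    fix f assume "f \<in> ?L"
    then have f: "(w, s) \<in> f"
      and "(\<exists>t e. f = layer t e \<and> e \<in> edges G) \<or> (\<exists>u. f = rung u)"
      unfolding edges_prism[OF assms(1)] by blast+
    then consider t e where "f = layer t e" "e \<in> edges G" | u where "f = rung u" by blast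
    then show "f \<in> ?R"
    proof cases
      case 1
      then have "s = t" "w \<in> e" using f by simp_all
      then show ?thesis using 1 by blast
    next
      case 2
      then have "u = w" using f by simp
      then show ?thesis using 2 by simp
    qed
  qed
  show "?R \<subseteq> ?L"
    using assms(2) unfolding edges_prism[OF assms(1)] by auto
qed

lemma degree_prism:
  assumes "simple_graph G" "w \<in> vertices G"
  shows "degree (G \<box> K2) (w, s) = Suc (degree G w)"
proof -
  have "rung w \<noteq> layer s e" for e
  proof
    assume "rung w = layer s e"
    \<comment> \<open>The rung also contains the copy of \<open>w\<close> in the other
      layer.\<close>
    then have "(w, \<not> s) \<in> layer s e" by (metis mem_rung)
    then show False by simp
  qed
  then have "rung w \<notin> layer s ` {e \<in> edges G. w \<in> e}" by blast
  moreover have "card (layer s ` {e \<in> edges G. w \<in> e}) = degree G w"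
    unfolding degree_def by (rule card_image[OF inj_on_subset[OF inj_layer]]) simp
  moreover have "finite (layer s ` {e \<in> edges G. w \<in> e})"
    using simple_graph_finite_edges[OF assms(1)] by simp
  ultimately show ?thesis
    unfolding degree_def[of "G \<box> K2"] prism_incident_edges[OF assms] by simp
qed

text \<open>Every degree grows by exactly one, and the monotone \<open>Suc\<close> commutes with
  \<open>Max\<close>. This provides the single cop beside the \<open>max_degree G\<close>
  others.\<close>

lemma max_degree_prism:
  assumes "simple_graph G" "vertices G \<noteq> {}"
  shows "max_degree (G \<box> K2) = Suc (max_degree G)"
proof -
  have "degree (G \<box> K2) ` vertices (G \<box> K2) = Suc ` degree G ` vertices G"
  proof -
    have "degree (G \<box> K2) ` vertices (G \<box> K2) = (\<lambda>p. Suc (degree G (fst p))) ` (vertices G \<times> (UNIV :: bool set))"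
      unfolding vertices_prism by (rule image_cong[OF refl]) (auto simp: degree_prism[OF assms(1)])
    also have "\<dots> = Suc ` degree G ` vertices G" by force
    finally show ?thesis .
  qed
  moreover have "finite (vertices G)" using assms by (simp add: simple_graph_def)
  ultimately show ?thesis
    unfolding max_degree_def using assms(2) by (simp add: mono_Max_commute[symmetric] mono_Suc)
qed

lemma degree_le_max_degree:
  assumes "simple_graph G" "w \<in> vertices G"
  shows "degree G w \<le> max_degree G"
  unfolding max_degree_def using assms by (auto simp: simple_graph_def)

lemma prism_edge_cases:
  assumes "simple_graph G" "{(x, s), (y, t)} \<in> edges (G \<box> K2)"
  obtains "x = y" | "s = t" "{x, y} \<in> edges G"
proof -
  from assms(2) consider r e where "{(x, s), (y, t)} = layer r e" "e \<in> edges G"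
    | u where "{(x, s), (y, t)} = rung u"
    unfolding edges_prism[OF assms(1)] by blast
  then show thesis
  proof cases
    case 1
    have "(x, s) \<in> layer r e" "(y, t) \<in> layer r e" unfolding 1(1)[symmetric] by simp_all
    then have st: "s = r" "t = r" by simp_all
    then have "layer r {x, y} = layer r e" using 1(1) by (simp add: layer_doubleton)
    then have "{x, y} = e" by (rule injD[OF inj_layer])
    then show thesis using that(2) st 1(2) by simp
  next
    case 2
    have "(x, s) \<in> rung u" "(y, t) \<in> rung u" unfolding 2[symmetric] by simp_all
    then show thesis using that(1) by simp
  qed
qed

section \<open>The cops' formations\<close>

text \<open>Cop positions are lists of fixed length, so surplus cops are put on an arbitrary element
  of \<open>A\<close>.\<close>

lemma finite_set_as_list:
  assumes "finite A" "A \<noteq> {}" "card A \<le> n"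
  obtains xs where "set xs = A" "length xs = n"
proof -
  obtain ys where ys: "set ys = A" "distinct ys" using finite_distinct_list[OF assms(1)] by blast
  obtain a where "a \<in> A" using assms(2) by blast
  moreover have "length ys \<le> n" using ys assms(3) by (metis distinct_card)
  ultimately show thesis
    using that[of "ys @ replicate (n - length ys) a"] ys
    by (auto simp: set_replicate_conv_if insert_absorb)
qed

text \<open>Every formation that the cops leave has a group on one edge \<open>f\<close> and a last
  cop on \<open>g\<close>. It is enough that target edges meet the current ones: an edge that meets
  another is equal to it, and the cop stays, or adjacent to it.\<close>

lemma cop_move_replicate_snoc:
  assumes "length es = n" "\<And>e. e \<in> set es \<Longrightarrow> e \<in> edges G \<and> f \<inter> e \<noteq> {}"
    and "h \<in> edges G" "g \<inter> h \<noteq> {}"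
  shows "cop_move G (replicate n f @ [g]) (es @ [h])"
  unfolding cop_move_def
proof (rule list_all2_appendI)
  show "list_all2 (\<lambda>e e'. e' = e \<or> e' \<in> edges G \<and> adjacent_edges e e') (replicate n f) es"
    using assms(1,2) by (auto simp: list_all2_conv_all_nth adjacent_edges_def)
  show "list_all2 (\<lambda>e e'. e' = e \<or> e' \<in> edges G \<and> adjacent_edges e e') [g] [h]"
    using assms(3,4) by (auto simp: adjacent_edges_def)
qed

locale tree_with_edges =
  fixes T :: "'a ugraph"
  assumes tree: "tree T" and edges_nonempty: "edges T \<noteq> {}"
begin

lemma simple: "simple_graph T"
  using tree by (simp add: tree_def connected_graph_def)

lemma layer_edge: "e \<in> edges T \<Longrightarrow> layer s e \<in> edges (T \<box> K2)"
  by (auto simp: edges_prism[OF simple])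

lemma rung_edge: "w \<in> vertices T \<Longrightarrow> rung w \<in> edges (T \<box> K2)"
  by (auto simp: edges_prism[OF simple])

text \<open>Ensures that the group of \<open>max_degree T\<close> cops is not empty and really
  occupies the edge assigned to it.\<close>

lemma max_degree_pos: "0 < max_degree T"
proof -
  obtain e where "e \<in> edges T" using edges_nonempty by blast
  then have "e \<noteq> {}" "e \<subseteq> vertices T" using simple by (auto simp: simple_graph_def)
  then obtain v where v: "v \<in> e" "v \<in> vertices T" by auto
  then have "{e \<in> edges T. v \<in> e} \<noteq> {}" using \<open>e \<in> edges T\<close> by blast
  then have "0 < degree T v"
    unfolding degree_def using simple_graph_finite_edges[OF simple] by (simp add: card_gt_0_iff)
  then show ?thesis using degree_le_max_degree[OF simple v(2)] by linarith
qed

definition guard :: "bool \<Rightarrow> 'a set \<Rightarrow> ('a \<times> bool) set list" where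
  "guard s e = replicate (max_degree T) (layer s e) @ [layer (\<not> s) e]"

lemma layer_in_guard: "layer t e \<in> set (guard s e)"
  using max_degree_pos by (cases "t = s") (auto simp: guard_def)

text \<open>A rung does not change the vertex of \<open>T\<close> below the robber, and a copy of a
  tree edge other than \<open>vw\<close> does not leave the side.\<close>

lemma robber_move_guard:
  assumes "robber_move (T \<box> K2) (guard s {v, w}) (x, t) p" "x \<in> side T v w"
  shows "fst p \<in> side T v w"
proof -
  obtain y r where p: "p = (y, r)" by (cases p)
  have "y \<in> side T v w"
  proof (cases "(y, r) = (x, t)")
    case False
    then have edge: "{(x, t), (y, r)} \<in> edges (T \<box> K2)"
      and free: "{(x, t), (y, r)} \<notin> set (guard s {v, w})"
      using assms(1) by (auto simp: robber_move_def p)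
    from prism_edge_cases[OF simple edge] show ?thesis
    proof cases
      case 1
      then show ?thesis using assms(2) by simp
    next
      case 2
      have "{x, y} \<noteq> {v, w}"
      proof
        assume eq: "{x, y} = {v, w}"
        have "layer t {x, y} \<in> set (guard s {v, w})" unfolding eq by (rule layer_in_guard)
        then show False using free 2(1) by (simp add: layer_doubleton)
      qed
      then show ?thesis by (rule side_step[OF assms(2) 2(2)])
    qed
  qed (use assms(2) in simp)
  then show ?thesis by (simp add: p)
qed

text \<open>At most \<open>max_degree T\<close> edges of \<open>T\<close> meet \<open>w\<close>, so
  the group in the robber's layer can cover all their copies, while the single cop reaches the rung
  from the other layer.\<close>

lemma contained_from_guard:
  assumes "{v, w} \<in> edges T"
  shows "\<exists>c. cop_move (T \<box> K2) (guard s {v, w}) c \<and> contained (T \<box> K2) c (w, s)"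
proof -
  have w: "w \<in> vertices T" using simple_graph_edge_vertices[OF simple assms] by simp
  let ?A = "{e \<in> edges T. w \<in> e}"
  have "finite ?A" using simple_graph_finite_edges[OF simple] by simp
  moreover have "?A \<noteq> {}" using assms by blast
  moreover have "card ?A \<le> max_degree T"
    using degree_le_max_degree[OF simple w] by (simp add: degree_def)
  ultimately obtain es where es: "set es = ?A" "length es = max_degree T"
    by (rule finite_set_as_list)
  let ?c = "map (layer s) es @ [rung w]"
  have "cop_move (T \<box> K2) (guard s {v, w}) ?c"
    unfolding guard_def
  proof (rule cop_move_replicate_snoc)
    show "length (map (layer s) es) = max_degree T" using es by simp
    show "f \<in> edges (T \<box> K2) \<and> layer s {v, w} \<inter> f \<noteq> {}" if "f \<in> set (map (layer s) es)" for f
      using that es layer_edge layer_meets_layer[of w] by auto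
    show "rung w \<in> edges (T \<box> K2)" using w by (rule rung_edge)
    show "layer (\<not> s) {v, w} \<inter> rung w \<noteq> {}" by (rule layer_meets_rung) simp
  qed
  moreover have "contained (T \<box> K2) ?c (w, s)"
    unfolding contained_iff prism_incident_edges[OF simple w] using es by auto
  ultimately show ?thesis by blast
qed

text \<open>The edge \<open>vw\<close> of the robber's layer is occupied by the last cop already, so the other
  \<open>max_degree T\<close> cops suffice for the rung and the remaining edges at \<open>w\<close>.\<close>

lemma contained_from_rung:
  assumes "{v, w} \<in> edges T"
  shows "\<exists>c. cop_move (T \<box> K2) (replicate (max_degree T) (rung w) @ [layer t {v, w}]) c \<and>
    contained (T \<box> K2) c (w, t)"
proof -
  have w: "w \<in> vertices T" using simple_graph_edge_vertices[OF simple assms] by simp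
  let ?A = "{e \<in> edges T. w \<in> e}"
  let ?B = "insert (rung w) (layer t ` (?A - {{v, w}}))"
  have fin: "finite ?A" using simple_graph_finite_edges[OF simple] by simp
  have "card ?B \<le> Suc (card (layer t ` (?A - {{v, w}})))" by (rule card_insert_le_m1) auto
  \<comment> \<open>The added rung and the removed edge \<open>vw\<close> balance, so the bound
    becomes the degree of \<open>w\<close> in \<open>T\<close>.\<close>
  also have "\<dots> \<le> Suc (card (?A - {{v, w}}))" using fin by (simp add: card_image_le)
  also have "\<dots> = card ?A" by (rule card.remove[symmetric]) (use fin assms in auto)
  also have "\<dots> \<le> max_degree T"
    using degree_le_max_degree[OF simple w] by (simp add: degree_def)
  finally have "card ?B \<le> max_degree T" .
  moreover have "finite ?B" using fin by simp
  ultimately obtain es where es: "set es = ?B" "length es = max_degree T"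
    using finite_set_as_list[of ?B] by blast
  let ?c = "es @ [layer t {v, w}]"
  have "cop_move (T \<box> K2) (replicate (max_degree T) (rung w) @ [layer t {v, w}]) ?c"
  proof (rule cop_move_replicate_snoc)
    show "f \<in> edges (T \<box> K2) \<and> rung w \<inter> f \<noteq> {}" if "f \<in> set es" for f
    proof -
      from that es consider "f = rung w" | e where "f = layer t e" "e \<in> edges T" "w \<in> e"
        by auto
      then show ?thesis
        by cases (use rung_edge[OF w] layer_edge rung_meets_layer in \<open>auto simp: rung_def\<close>)
    qed
  qed (use es assms layer_edge in simp_all)
  moreover have "contained (T \<box> K2) ?c (w, t)"
    unfolding contained_iff prism_incident_edges[OF simple w] using es by auto
  ultimately show ?thesis by blast
qed

section \<open>Moves between the formations\<close>

lemma cop_move_guard_guard: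
  assumes "{w, w'} \<in> edges T"
  shows "cop_move (T \<box> K2) (guard s {v, w}) (guard s {w, w'})"
  unfolding guard_def
  by (rule cop_move_replicate_snoc)
    (use assms layer_edge layer_meets_layer[of w "{v, w}"] in simp_all)

text \<open>The answer to a robber at the copy of \<open>w\<close> in the single cop's layer. She
  stays and bars his way to \<open>v\<close>; the copy of \<open>vw\<close> in layer
  \<open>s\<close> may be left open, because the rung is blocked.\<close>

lemma cop_move_guard_rung:
  assumes "{v, w} \<in> edges T"
  shows "cop_move (T \<box> K2) (guard s {v, w})
    (replicate (max_degree T) (rung w) @ [layer (\<not> s) {v, w}])"
  unfolding guard_def
proof (rule cop_move_replicate_snoc)
  have w: "w \<in> vertices T" using simple_graph_edge_vertices[OF simple assms] by simp
  show "f \<in> edges (T \<box> K2) \<and> layer s {v, w} \<inter> f \<noteq> {}"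
    if "f \<in> set (replicate (max_degree T) (rung w))" for f
    using that rung_edge[OF w] layer_meets_rung[of w] by auto
qed (use assms layer_edge layer_meets_layer[of w "{v, w}"] in simp_all)

text \<open>The single cop can only reach the copy of \<open>ww'\<close> in her own layer
  \<open>t\<close>, so the group takes the one in layer \<open>\<not> t\<close>.\<close>

lemma cop_move_rung_guard:
  assumes "{w, w'} \<in> edges T"
  shows "cop_move (T \<box> K2) (replicate (max_degree T) (rung w) @ [layer t {v, w}])
    (guard (\<not> t) {w, w'})"
  unfolding guard_def
proof (rule cop_move_replicate_snoc)
  show "f \<in> edges (T \<box> K2) \<and> rung w \<inter> f \<noteq> {}"
    if "f \<in> set (replicate (max_degree T) (layer (\<not> t) {w, w'}))" for f
    using that layer_edge[OF assms] rung_meets_layer[of w] by auto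
qed (use assms layer_edge layer_meets_layer[of w "{v, w}"] in simp_all)

text \<open>With the rung and the robber's copy of \<open>vw\<close> occupied, the only ways out are
  copies of other edges at \<open>w\<close> in his own layer.\<close>

lemma robber_move_rung:
  assumes "robber_move (T \<box> K2) (replicate (max_degree T) (rung w) @ [layer t {v, w}]) (w, t) p"
    and "p \<noteq> (w, t)"
  obtains w' where "p = (w', t)" "{w, w'} \<in> edges T" "w' \<noteq> v"
proof -
  obtain y r where p: "p = (y, r)" by (cases p)
  have edge: "{(w, t), (y, r)} \<in> edges (T \<box> K2)"
    and free: "{(w, t), (y, r)} \<notin> set (replicate (max_degree T) (rung w) @ [layer t {v, w}])"
    using assms by (auto simp: robber_move_def p)
  from prism_edge_cases[OF simple edge] show thesis
  proof cases
    case 1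
    then have "{(w, t), (y, r)} = rung w" using assms(2) p by (auto simp: rung_def)
    then show thesis using free max_degree_pos by auto
  next
    case 2
    moreover have "y \<noteq> v" using free 2 by (auto simp: layer_doubleton insert_commute)
    ultimately show thesis using that p by simp
  qed
qed

text \<open>Induction on the size of the territory. Advancing by one tree edge costs at most two
  turns, the second one only if the cops pass through the rung; hence the factor 2.\<close>

lemma cops_win_from_guard:
  assumes "{v, w} \<in> edges T" "x \<in> side T v w" "2 * card (side T v w) \<le> n"
  shows "cops_win_within (T \<box> K2) n (guard s {v, w}) (x, t)"
  using assms
proof (induction "card (side T v w)" arbitrary: v w x s t n rule: less_induct)
  case less
  note vw = less.prems(1)
  have "w \<in> vertices T" using simple_graph_edge_vertices[OF simple vw] by simp
  then have fin: "finite (side T v w)"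
    using side_subset_vertices[OF simple] simple finite_subset unfolding simple_graph_def by metis
  have "0 < card (side T v w)" using fin side_self[of w T v] by (auto simp: card_gt_0_iff)
  then have "2 \<le> n" using less.prems by linarith
  then have "n = Suc (Suc (n - 2))" by simp
  then obtain n' where n': "n = Suc (Suc n')" ..
  \<comment> \<open>The smaller side lowers the bound by at least 2, so the \<open>n'\<close> turns
    left after two are enough.\<close>
  have advance: "cops_win_within (T \<box> K2) m (guard s' {w, w'}) (y, t')"
    if "{w, w'} \<in> edges T" "w' \<noteq> v" "y \<in> side T w w'" "n' \<le> m" for w' y m s' t'
  proof -
    have "card (side T w w') < card (side T v w)"
      using fin tree_side_psubset[OF tree that(1,2)] by (rule psubset_card_mono)
    then show ?thesis using less.hyps[of w w'] less.prems(3) that n' by simp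
  qed
  \<comment> \<open>One cops' turn together with the robber's reply, which stays in the new side.
    The position \<open>c\<close> is left open because the new guard is reached from the old guard
    or from the rung.\<close>
  have shift: "cops_win_within (T \<box> K2) (Suc m) c (y, t')"
    if move: "cop_move (T \<box> K2) c (guard s' {w, w'})"
      and w': "{w, w'} \<in> edges T" "w' \<noteq> v" "y \<in> side T w w'" "n' \<le> m" for c w' y m s' t'
  proof -
    have "cops_win_within (T \<box> K2) m (guard s' {w, w'}) p"
      if "robber_move (T \<box> K2) (guard s' {w, w'}) (y, t') p" for p
      using advance[OF w'(1,2) robber_move_guard[OF that w'(3)] w'(4), of s' "snd p"] by simp
    then show ?thesis using move by auto
  qed
  consider (far) "x \<noteq> w" | (same) "x = w" "t = s" | (other) "x = w" "t = (\<not> s)" by blast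
  then show ?case
  proof cases
    case far
    then obtain w' where w': "{w, w'} \<in> edges T" "w' \<noteq> v" "x \<in> side T w w'"
      using side_next_edge less.prems(2) by metis
    show ?thesis unfolding n' by (rule shift[OF cop_move_guard_guard[OF w'(1)] w']) simp
  next
    case same
    then show ?thesis unfolding n' using contained_from_guard[OF vw] by auto
  next
    case other
    let ?c = "replicate (max_degree T) (rung w) @ [layer t {v, w}]"
    have "cops_win_within (T \<box> K2) (Suc n') ?c p"
      if p: "robber_move (T \<box> K2) ?c (x, t) p" for p
    proof (cases "p = (w, t)")
      case True
      then show ?thesis using contained_from_rung[OF vw] by auto
    next
      case False
      then obtain w' where w': "p = (w', t)" "{w, w'} \<in> edges T" "w' \<noteq> v"
        using robber_move_rung p other by metis
      show ?thesis
        unfolding w'(1) by (rule shift[OF cop_move_rung_guard[OF w'(2)] w'(2,3) side_self]) simp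
    qed
    moreover have "cop_move (T \<box> K2) (guard s {v, w}) ?c"
      using cop_move_guard_rung[OF vw] other by simp
    ultimately show ?thesis unfolding n' cops_win_within.simps(2)[of _ "Suc n'"] by blast
  qed
qed

lemma containable_prism: "containable (T \<box> K2)"
proof -
  have conn: "connected_graph T" using tree by (simp add: tree_def)
  obtain v w where vw: "{v, w} \<in> edges T"
    using edges_nonempty simple_graph_edgeE[OF simple] by (metis all_not_in_conv)
  note V = simple_graph_edge_vertices[OF simple vw]
  have finite: "finite (vertices T)" using simple by (simp add: simple_graph_def)
  \<comment> \<open>One bound for both sides, as the robber picks his side after the cops are
    placed.\<close>
  have size: "2 * card (side T a b) \<le> 2 * card (vertices T)" if "b \<in> vertices T" for a b
    using card_mono[OF finite side_subset_vertices[OF simple that]] by simp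
  have "cops_win_within (T \<box> K2) (2 * card (vertices T)) (guard True {v, w}) (x, t)"
    if "x \<in> vertices T" for x t
  proof -
    from V that have "x \<in> side T v w \<or> x \<in> side T w v"
      using connected_graph_sides[OF conn] by blast
    then show ?thesis
    proof
      assume "x \<in> side T v w"
      then show ?thesis using cops_win_from_guard vw size V by blast
    next
      assume "x \<in> side T w v"
      \<comment> \<open>The guard depends only on the unordered edge, so the same placement also
        confronts a robber on the side of \<open>v\<close>.\<close>
      moreover have "{w, v} \<in> edges T" using vw by (simp add: insert_commute)
      ultimately have "cops_win_within (T \<box> K2) (2 * card (vertices T)) (guard True {w, v}) (x, t)"
        using cops_win_from_guard size V by blast
      then show ?thesis by (simp add: insert_commute)
    qed
  qed
  moreover have "guard True {v, w} \<in> cop_positions (T \<box> K2) (max_degree (T \<box> K2))"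
    using conn vw layer_edge
    by (auto simp: cop_positions_def guard_def max_degree_prism[OF simple] connected_graph_def
        set_replicate_conv_if)
  ultimately have "\<exists>\<sigma>. winning_strategy (T \<box> K2) (max_degree (T \<box> K2)) \<sigma>"
    by (intro winning_strategy_if_cops_win_within) (auto simp: vertices_prism)
  then show ?thesis using connected_graph_prism[OF conn] by (simp add: containable_def)
qed

end

text \<open>A connected graph without edges is a single vertex, so its prism is a single edge and
  one cop on it contains the robber at once.\<close>

lemma containable_prism_edgeless:
  assumes conn: "connected_graph G" and "edges G = {}"
  shows "containable (G \<box> K2)"
proof -
  have simple: "simple_graph G" and "vertices G \<noteq> {}"
    using conn by (auto simp: connected_graph_def)
  then obtain v where v: "v \<in> vertices G" by blast
  have "u = v" if "u \<in> vertices G" for u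
    using conn that v assms(2) by (auto simp: connected_graph_def)
  with v have V: "vertices G = {v}" by blast
  have E: "edges (G \<box> K2) = {rung v}" using V assms(2) by (auto simp: edges_prism[OF simple])
  have "max_degree G = 0" by (simp add: max_degree_def V degree_def assms(2))
  then have pos: "[rung v] \<in> cop_positions (G \<box> K2) (max_degree (G \<box> K2))"
    using E V by (simp add: cop_positions_def max_degree_prism[OF simple])
  \<comment> \<open>The count is 1 because containment is tested only after a cops' turn, here one
    in which the cop stays.\<close>
  have "cops_win_within (G \<box> K2) 1 [rung v] p" for p
    using E cop_move_refl[of "G \<box> K2" "[rung v]"] by (auto simp: contained_def)
  with pos have "\<exists>\<sigma>. winning_strategy (G \<box> K2) (max_degree (G \<box> K2)) \<sigma>"
    by (intro winning_strategy_if_cops_win_within)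
  then show ?thesis using connected_graph_prism[OF conn] by (simp add: containable_def)
qed

theorem theorem3p4:
  fixes T :: "'a ugraph"
  assumes "tree T"
  shows "containable (T \<box> K2)"
proof (cases "edges T = {}")
  case True
  then show ?thesis using assms containable_prism_edgeless by (auto simp: tree_def)
next
  case False
  then interpret tree_with_edges T using assms by unfold_locales
  show ?thesis by (rule containable_prism)
qed

end
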